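(* Let $(A,\star)$ be a finite group and $k>1$. Then $\mathcal{M}(\mathcal{B}_k(A),\chi_k(A))$ is a reset Mealy automaton whose modified state functions are all different. In particular, the associated automata semigroup $\mathcal{S}(\mathcal{M}(\mathcal{B}_k(A),\chi_k(A)))$ is free.
   Context: The De Bruijn automaton $\mathcal{B}_k(A)=(Q,A,\delta)$ has state set $Q=A^k$ (words of length $k$ over $A$) and transitions $\delta(ys,x)=sx$ for $x,y\in A$, $s\in A^{k-1}$. The coloring $\chi_k(A)$ gives the Mealy automaton $\mathcal{M}(\mathcal{B}_k(A),\chi_k(A))=(Q,A,\delta,\lambda)$ with output function $\lambda(ys,x)=x\star y^{-1}$ for $x,y\in A$, $s\in A^{k-1}$. For a Mealy automaton $\mathcal{M}=(Q,A,\delta,\lambda)$ write $q\cdot a=\delta(q,a)$, $q\circ a=\lambda(q,a)$, extended to words by $q\cdot(ua)=(q\cdot u)\cdot a$ and $q\circ(ua)=(q\circ u)((q\cdot u)\circ a)$, and $Q\cdot u=\{q\cdot u:q\in Q\}$. For $q\in Q$ set $\mathcal{M}_q:A^*\to A^*$, $\mathcal{M}_q(u)=q\circ u$; $\mathcal{S}(\mathcal{M})$ is the semigroup of transformations of $A^*$ generated by $\{\mathcal{M}_q:q\in Q\}$. $\mathrm{Syn}(\mathcal{M})=\{u\in A^*:|Q\cdot u|=1\}$; $\mathcal{M}$ is synchronizing if $\mathrm{Syn}(\mathcal{M})\neq\emptyset$, and reset if moreover $\mathcal{M}_q(\mathrm{Syn}(\mathcal{M}))\subseteq\mathrm{Syn}(\mathcal{M})$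 for every $q\in Q$. For a reset $\mathcal{M}$, the modified state function $\widetilde{\lambda_q}:\mathrm{Syn}(\mathcal{M})\to Q$ sends $u$ to the unique element of $Q\cdot(q\circ u)$.
   Formalization: Freeness of the automata semigroup is stated only for groups A with more than one element: for the trivial group the only state acts as the identity, so the semigroup is {id}, which is finite and not a free semigroup. *)

theory Defs
  imports "HOL-Algebra.Group" "HOL-Library.FuncSet"
begin

section \<open>Automata and Mealy automata\<close>

record ('q, 'a) automaton =
  states :: "'q set"
  alphabet :: "'a set"
  trans :: "'q \<Rightarrow> 'a \<Rightarrow> 'q"

record ('q, 'a) mealy = "('q, 'a) automaton" +
  out :: "'q \<Rightarrow> 'a \<Rightarrow> 'a"

definition mealy_automaton :: "('q, 'a) mealy \<Rightarrow> bool" where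
  "mealy_automaton M \<longleftrightarrow>
     finite (states M) \<and> finite (alphabet M) \<and>
     (\<forall>q\<in>states M. \<forall>a\<in>alphabet M.
        trans M q a \<in> states M \<and> out M q a \<in> alphabet M)"

definition mealy_of :: "('q, 'a) automaton \<Rightarrow> ('q \<Rightarrow> 'a \<Rightarrow> 'a) \<Rightarrow> ('q, 'a) mealy" where
  "mealy_of B c = \<lparr>states = states B, alphabet = alphabet B, trans = trans B, out = c\<rparr>"

definition trans_word :: "('q, 'a, 'm) automaton_scheme \<Rightarrow> 'q \<Rightarrow> 'a list \<Rightarrow> 'q" where
  "trans_word M q u = foldl (trans M) q u"

primrec out_word :: "('q, 'a) mealy \<Rightarrow> 'q \<Rightarrow> 'a list \<Rightarrow> 'a list" where
  "out_word M q [] = []"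
| "out_word M q (a # u) = out M q a # out_word M (trans M q a) u"

lemma trans_word_snoc: "trans_word M q (u @ [a]) = trans M (trans_word M q u) a"
  by (simp add: trans_word_def)

lemma out_word_snoc: "out_word M q (u @ [a]) = out_word M q u @ [out M (trans_word M q u) a]"
  by (induction u arbitrary: q) (simp_all add: trans_word_def)


section \<open>Synchronizing words and modified state functions\<close>

definition reach :: "('q, 'a, 'm) automaton_scheme \<Rightarrow> 'a list \<Rightarrow> 'q set" where
  "reach M u = (\<lambda>q. trans_word M q u) ` states M"

definition Syn :: "('q, 'a, 'm) automaton_scheme \<Rightarrow> 'a list set" where
  "Syn M = {u \<in> lists (alphabet M). card (reach M u) = 1}"

definition state_fun :: "('q, 'a) mealy \<Rightarrow> 'q \<Rightarrow> 'a list \<Rightarrow> 'a list" where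
  "state_fun M q = (\<lambda>u\<in>lists (alphabet M). out_word M q u)"

definition synchronizing :: "('q, 'a, 'm) automaton_scheme \<Rightarrow> bool" where
  "synchronizing M \<longleftrightarrow> Syn M \<noteq> {}"

definition reset_mealy :: "('q, 'a) mealy \<Rightarrow> bool" where
  "reset_mealy M \<longleftrightarrow>
     mealy_automaton M \<and> synchronizing M \<and>
     (\<forall>q\<in>states M. state_fun M q ` Syn M \<subseteq> Syn M)"

text \<open>Thanks to the restriction to \<open>Syn M\<close>, equality of these functions is equality on \<open>Syn M\<close>.\<close>

definition modified_state_fun :: "('q, 'a) mealy \<Rightarrow> 'q \<Rightarrow> 'a list \<Rightarrow> 'q" where
  "modified_state_fun M q = (\<lambda>u\<in>Syn M. THE p. p \<in> reach M (out_word M q u))"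


section \<open>Generated and free semigroups\<close>

inductive_set generated_semigroup :: "('s \<Rightarrow> 's \<Rightarrow> 's) \<Rightarrow> 's set \<Rightarrow> 's set"
  for m :: "'s \<Rightarrow> 's \<Rightarrow> 's" and X :: "'s set" where
  gen: "x \<in> X \<Longrightarrow> x \<in> generated_semigroup m X"
| mult: "x \<in> generated_semigroup m X \<Longrightarrow> y \<in> generated_semigroup m X \<Longrightarrow>
         m x y \<in> generated_semigroup m X"

definition automaton_semigroup :: "('q, 'a) mealy \<Rightarrow> ('a list \<Rightarrow> 'a list) set" where
  "automaton_semigroup M =
     generated_semigroup (compose (lists (alphabet M))) (state_fun M ` states M)"

text \<open>A semigroup is free if it is isomorphic to the semigroup of nonempty words over some set
  \<open>X\<close>. It is no restriction to take \<open>X\<close> in the type of the elements of \<open>S\<close>, since an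
  isomorphism \<open>f\<close> embeds \<open>X\<close> into \<open>S\<close> by \<open>x \<mapsto> f [x]\<close>.\<close>

definition free_semigroup :: "'s set \<Rightarrow> ('s \<Rightarrow> 's \<Rightarrow> 's) \<Rightarrow> bool" where
  "free_semigroup S m \<longleftrightarrow>
     (\<exists>(X :: 's set) f. bij_betw f (lists X - {[]}) S \<and>
        (\<forall>u \<in> lists X - {[]}. \<forall>v \<in> lists X - {[]}. f (u @ v) = m (f u) (f v)))"

text \<open>A nonempty free semigroup is infinite. This is why freeness of the automaton semigroup of
  the De Bruijn automaton below can hold only for nontrivial groups: over a one-element alphabet
  the only state acts as the identity.\<close>

lemma free_semigroup_infinite:
  assumes "free_semigroup S m" and "S \<noteq> {}"
  shows "infinite S"
proof -
  obtain X :: "'a set" and f where f: "bij_betw f (lists X - {[]}) S"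
    using assms(1) unfolding free_semigroup_def by blast
  have "lists X - {[]} \<noteq> {}"
    using f assms(2) by (auto simp: bij_betw_def)
  then obtain x where x: "x \<in> X"
    by (metis Diff_eq_empty_iff all_not_in_conv lists_empty subset_refl)
  have "inj (\<lambda>n. replicate (Suc n) x)"
    by (intro injI) (metis length_replicate nat.inject)
  moreover have "range (\<lambda>n. replicate (Suc n) x) \<subseteq> lists X - {[]}"
    using x by (auto simp: in_lists_conv_set)
  ultimately have "infinite (lists X - {[]})"
    by (meson finite_imageD finite_subset infinite_UNIV_nat)
  then show ?thesis
    using f bij_betw_finite by blast
qed


section \<open>The De Bruijn automaton and its coloring by a group\<close>

definition de_bruijn :: "nat \<Rightarrow> 'a set \<Rightarrow> ('a list, 'a) automaton" where
  "de_bruijn k A =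
     \<lparr>states = {w \<in> lists A. length w = k}, alphabet = A, trans = (\<lambda>w x. tl w @ [x])\<rparr>"

definition group_coloring :: "('a, 'b) monoid_scheme \<Rightarrow> 'a list \<Rightarrow> 'a \<Rightarrow> 'a" where
  "group_coloring G w x = x \<otimes>\<^bsub>G\<^esub> inv\<^bsub>G\<^esub> (hd w)"

definition de_bruijn_mealy :: "nat \<Rightarrow> ('a, 'b) monoid_scheme \<Rightarrow> ('a list, 'a) mealy" where
  "de_bruijn_mealy k G = mealy_of (de_bruijn k (carrier G)) (group_coloring G)"

end

theory Submission imports Defs begin

text \<open>
  Reading \<open>k\<close> letters overwrites the state, and the output on a word of length \<open>k\<close> determines the
  initial state by cancellation in the group; hence the modified state functions differ. Moreover
  every state acts bijectively on words. Suppose two products of states act equally. If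
  their rightmost factors agree, they cancel. Otherwise read a word \<open>w\<close> of length \<open>k\<close>: both
  rightmost factors become \<open>w\<close> and cancel, while the next factors become the two distinct outputs of
  the old rightmost factors. Induction shows that two products of equal length which act equally are
  equal, and that products of different length acting equally yield a nonempty product acting as the
  identity. Reading two different words of length \<open>k\<close> turns such a product into two products
  of equal length with different rightmost factors, both acting as the identity, which is impossible.
\<close>

section \<open>Products of states and their sections\<close>

abbreviation act :: "('q, 'a) mealy \<Rightarrow> 'q list \<Rightarrow> 'a list \<Rightarrow> 'a list" where
  "act M qs u \<equiv> foldr (out_word M) qs u"

text \<open>The section of a product at the word \<open>u\<close>: each factor moves along the
  output of the product to its right, the rightmost factor along \<open>u\<close> itself.\<close>

primrec step :: "('q, 'a) mealy \<Rightarrow> 'q list \<Rightarrow> 'a list \<Rightarrow> 'q list" where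
  "step M [] u = []"
| "step M (q # qs) u = trans_word M q (act M qs u) # step M qs u"

lemma length_step [simp]: "length (step M qs u) = length qs"
  by (induction qs) auto

lemma step_append: "step M (ps @ qs) u = step M ps (act M qs u) @ step M qs u"
  by (induction ps) auto

lemma length_out_word [simp]: "length (out_word M q u) = length u"
  by (induction u arbitrary: q) auto

lemma length_act [simp]: "length (act M qs u) = length u"
  by (induction qs) auto

lemma out_word_append:
  "out_word M q (u @ v) = out_word M q u @ out_word M (trans_word M q u) v"
  by (induction u arbitrary: q) (auto simp: trans_word_def)

lemma act_append_word: "act M qs (u @ v) = act M qs u @ act M (step M qs u) v"
  by (induction qs) (auto simp: out_word_append)

text \<open>Both outputs on \<open>u @ v\<close> split after \<open>length u\<close> letters,
  because actions preserve length, so the tails can be compared.\<close>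

lemma act_step_eqI:
  assumes "\<And>v. v \<in> lists A \<Longrightarrow> act M ps v = act M qs v" "u \<in> lists A" "v \<in> lists A"
  shows "act M (step M ps u) v = act M (step M qs u) v"
proof -
  have "act M ps (u @ v) = act M qs (u @ v)"
    using assms by (intro assms(1)) auto
  then show ?thesis
    by (simp add: act_append_word)
qed

lemma trans_word_in_states:
  assumes "mealy_automaton M" "q \<in> states M" "u \<in> lists (alphabet M)"
  shows "trans_word M q u \<in> states M"
  using assms(3,2)
  by (induction u arbitrary: q) (use assms(1) in \<open>auto simp: trans_word_def mealy_automaton_def\<close>)

lemma out_word_in_lists:
  assumes "mealy_automaton M" "q \<in> states M" "u \<in> lists (alphabet M)"
  shows "out_word M q u \<in> lists (alphabet M)"
  using assms(3,2)
  by (induction u arbitrary: q) (use assms(1) in \<open>auto simp: mealy_automaton_def\<close>)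

lemma act_in_lists:
  assumes "mealy_automaton M" "qs \<in> lists (states M)" "u \<in> lists (alphabet M)"
  shows "act M qs u \<in> lists (alphabet M)"
  using assms(2) by (induction qs) (use assms(1,3) in \<open>simp_all del: in_lists_conv_set add: out_word_in_lists\<close>)

lemma step_in_lists:
  assumes "mealy_automaton M" "qs \<in> lists (states M)" "u \<in> lists (alphabet M)"
  shows "step M qs u \<in> lists (states M)"
  using assms(2)
  by (induction qs) (use assms(1,3) in
      \<open>simp_all del: in_lists_conv_set add: trans_word_in_states act_in_lists\<close>)

section \<open>A freeness criterion for automaton semigroups\<close>

lemma free_automaton_semigroup:
  assumes M: "mealy_automaton M"
    and faithful: "\<And>ps qs. \<lbrakk>ps \<in> lists (states M); qs \<in> lists (states M);
      \<And>u. u \<in> lists (alphabet M) \<Longrightarrow> act M ps u = act M qs u\<rbrakk> \<Longrightarrow> ps = qs"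
  shows "free_semigroup (automaton_semigroup M) (compose (lists (alphabet M)))"
proof -
  define L where "L = lists (alphabet M)"
  define X where "X = state_fun M ` states M"
  \<comment> \<open>The candidate isomorphism composes a word of functions, rightmost first; the
    restriction makes its values extensional on \<open>L\<close>, as \<open>compose L\<close>
    requires.\<close>
  define f where "f fs = (\<lambda>u\<in>L. foldr (\<lambda>g. g) fs u)" for fs :: "('b list \<Rightarrow> 'b list) list"
  have f_map: "f (map (state_fun M) qs) u = act M qs u"
    if "qs \<in> lists (states M)" "u \<in> L" for qs u
  proof -
    have "foldr (\<lambda>g. g) (map (state_fun M) qs) u = act M qs u"
      using that(1)
    proof (induction qs)
      case (Cons q qs)
      then show ?case
        using act_in_lists[OF M Cons(2)] that(2) by (auto simp: state_fun_def L_def)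
    qed simp
    then show ?thesis
      using that(2) by (simp add: f_def)
  qed
  have X_map: "\<exists>qs\<in>lists (states M). fs = map (state_fun M) qs" if "fs \<in> lists X" for fs
    using that unfolding X_def lists_image by blast
  have in_L: "f fs u \<in> L" if "fs \<in> lists X" "u \<in> L" for fs u
    using X_map[OF that(1)] that(2) f_map act_in_lists[OF M] unfolding L_def by fastforce
  have f_append: "f (us @ vs) = compose L (f us) (f vs)" if "us \<in> lists X" "vs \<in> lists X" for us vs
    using in_L[OF that(2)] by (auto simp: f_def compose_def fun_eq_iff)
  have f_single: "f [x] = x" if "x \<in> X" for x
    using that unfolding X_def f_def state_fun_def L_def by (auto intro!: restrict_ext)
  \<comment> \<open>Both words of functions lift to lists of states; faithfulness identifies the
    lists, hence the words.\<close>
  have "inj_on f (lists X - {[]})"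
  proof (rule inj_onI)
    fix fs gs assume "fs \<in> lists X - {[]}" "gs \<in> lists X - {[]}" and eq: "f fs = f gs"
    then obtain ps qs where ps: "ps \<in> lists (states M)" "fs = map (state_fun M) ps"
      and qs: "qs \<in> lists (states M)" "gs = map (state_fun M) qs"
      using X_map by (metis Diff_iff)
    have "ps = qs"
      using ps(1) qs(1)
    proof (rule faithful)
      fix u assume "u \<in> lists (alphabet M)"
      then show "act M ps u = act M qs u"
        using f_map[OF ps(1)] f_map[OF qs(1)] eq ps(2) qs(2) by (simp add: L_def)
    qed
    then show "fs = gs"
      using ps qs by simp
  qed
  moreover have "f ` (lists X - {[]}) = generated_semigroup (compose L) X"
  proof (intro equalityI subsetI)
    fix y assume "y \<in> f ` (lists X - {[]})"
    then obtain fs where fs: "fs \<in> lists X" "fs \<noteq> []" "y = f fs"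
      by blast
    have "f fs \<in> generated_semigroup (compose L) X"
      using fs(2,1)
    proof (induction fs rule: list_nonempty_induct)
      case (single x)
      then show ?case
        by (auto simp: f_single intro: generated_semigroup.gen)
    next
      case (cons x xs)
      then have "f (x # xs) = compose L x (f xs)"
        using f_append[of "[x]" xs] f_single[of x] by simp
      then show ?case
        using cons by (auto intro: generated_semigroup.intros)
    qed
    then show "y \<in> generated_semigroup (compose L) X"
      using fs by simp
  next
    fix y assume "y \<in> generated_semigroup (compose L) X"
    then show "y \<in> f ` (lists X - {[]})"
    proof induction
      case (gen x)
      then show ?case
        using f_single[of x] by (intro image_eqI[of _ _ "[x]"]) auto
    next
      case (mult x y)
      then obtain us vs where us: "us \<in> lists X - {[]}" "x = f us"
        and vs: "vs \<in> lists X - {[]}" "y = f vs"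
        by blast
      then show ?case
        using f_append[of us vs] by (intro image_eqI[of _ _ "us @ vs"]) auto
    qed
  qed
  ultimately have "bij_betw f (lists X - {[]}) (automaton_semigroup M)"
    by (simp add: bij_betw_def automaton_semigroup_def X_def L_def)
  then show ?thesis
    unfolding free_semigroup_def using f_append L_def by blast
qed

section \<open>The De Bruijn automaton: reset property and modified state functions\<close>

locale group_de_bruijn = group G for G (structure) +
  fixes k :: nat
  assumes finite_carrier: "finite (carrier G)" and k_pos: "k > 0"
begin

abbreviation M where "M \<equiv> de_bruijn_mealy k G"

lemma M_simps [simp]:
  "states M = {w \<in> lists (carrier G). length w = k}" "alphabet M = carrier G"
  "trans M w x = tl w @ [x]" "out M w x = x \<otimes> inv (hd w)"
  by (simp_all add: de_bruijn_mealy_def mealy_of_def de_bruijn_def group_coloring_def)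

lemma hd_in_carrier: "w \<in> states M \<Longrightarrow> hd w \<in> carrier G"
  using k_pos by (cases w) auto

lemma trans_in_states: "w \<in> states M \<Longrightarrow> a \<in> carrier G \<Longrightarrow> tl w @ [a] \<in> states M"
  using k_pos by (cases w) auto

lemma mealy_automaton: "mealy_automaton M"
proof -
  have "finite {w \<in> lists (carrier G). length w = k}"
    using finite_lists_length_eq[OF finite_carrier, of k] by (simp add: lists_eq_set)
  then show ?thesis
    using finite_carrier hd_in_carrier trans_in_states by (simp add: mealy_automaton_def)
qed

text \<open>The automaton is a shift register whose state is a window of \<open>k\<close> letters on
  \<open>q @ u\<close>; truncated subtraction covers words shorter and longer than \<open>k\<close>
  in one formula.\<close>

lemma trans_word_eq:
  assumes "length q = k"
  shows "trans_word M q u = drop (length u) q @ drop (length u - k) u"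
proof -
  have "trans_word M q u = drop (length u) (q @ u)"
    using assms
  proof (induction u arbitrary: q)
    case (Cons a u)
    then have "q \<noteq> []"
      using k_pos by auto
    then show ?case
      using Cons.IH[of "tl q @ [a]"] Cons.prems by (cases q) (auto simp: trans_word_def)
  qed (simp add: trans_word_def)
  then show ?thesis
    using assms by simp
qed

text \<open>All reached states share the suffix coming from \<open>u\<close>, so their number
  depends only on \<open>length u\<close>. As outputs preserve length, \<open>Syn M\<close> is
  invariant.\<close>

lemma card_reach: "card (reach M u) = card (drop (length u) ` states M)"
proof -
  have "reach M u = (\<lambda>d. d @ drop (length u - k) u) ` drop (length u) ` states M"
    unfolding reach_def image_image by (intro image_cong) (auto simp: trans_word_eq)
  then show ?thesis
    by (simp add: card_image inj_on_def)
qed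

lemma replicate_one: "replicate k \<one> \<in> states M"
  by (auto simp: in_lists_conv_set)

lemma reach_state: "w \<in> states M \<Longrightarrow> reach M w = {w}"
  using replicate_one by (auto simp: reach_def trans_word_eq)

lemma states_subset_Syn: "states M \<subseteq> Syn M"
proof
  fix w assume "w \<in> states M"
  then show "w \<in> Syn M"
    using reach_state[of w] by (simp add: Syn_def)
qed

lemma out_word_in_Syn:
  assumes "q \<in> states M" "u \<in> Syn M"
  shows "out_word M q u \<in> Syn M"
  using assms out_word_in_lists[OF mealy_automaton assms(1), of u]
  by (simp add: Syn_def card_reach)

lemma reset_mealy: "reset_mealy M"
proof -
  have "Syn M \<noteq> {}"
    using states_subset_Syn replicate_one by blast
  moreover have "state_fun M q u = out_word M q u" if "u \<in> Syn M" for q u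
    using that by (simp add: state_fun_def Syn_def)
  ultimately show ?thesis
    using out_word_in_Syn by (auto simp: reset_mealy_def mealy_automaton synchronizing_def)
qed

text \<open>The output letter \<open>a \<otimes> inv (hd p)\<close> determines \<open>hd p\<close>.
  Reading \<open>a\<close> then shifts both states alike, and \<open>length u \<le> k\<close> keeps
  the appended letters out of the compared prefixes.\<close>

lemma take_eq_if_out_word_eq:
  assumes "p \<in> states M" "q \<in> states M" "u \<in> lists (carrier G)" "length u \<le> k"
    and "out_word M p u = out_word M q u"
  shows "take (length u) p = take (length u) q"
  using assms(3,1,2,4,5)
proof (induction u arbitrary: p q)
  case (Cons a u)
  have hd: "hd p \<in> carrier G" "hd q \<in> carrier G"
    using hd_in_carrier Cons.prems by blast+
  have "a \<otimes> inv (hd p) = a \<otimes> inv (hd q)"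
    using Cons.prems by simp
  then have "hd p = hd q"
    using hd Cons.hyps(1) by (metis Units_eq Units_l_cancel inv_closed inv_inv)
  moreover have "take (length u) (tl p @ [a]) = take (length u) (tl q @ [a])"
    using Cons.prems Cons.hyps by (intro Cons.IH trans_in_states) simp_all
  ultimately show ?case
    using Cons.prems k_pos by (cases p; cases q) auto
qed simp

lemma state_eq_if_out_word_eq:
  assumes "p \<in> states M" "q \<in> states M" "w \<in> states M" "out_word M p w = out_word M q w"
  shows "p = q"
  using take_eq_if_out_word_eq[of p q w] assms by simp

lemma inj_on_modified_state_fun: "inj_on (modified_state_fun M) (states M)"
proof (rule inj_onI)
  fix p q assume pq: "p \<in> states M" "q \<in> states M"
    and eq: "modified_state_fun M p = modified_state_fun M q"
  let ?w = "replicate k \<one>"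
  \<comment> \<open>The output on \<open>?w\<close> has length \<open>k\<close>, so it resets every
    state to itself.\<close>
  have "modified_state_fun M r ?w = out_word M r ?w" if "r \<in> states M" for r
  proof -
    have "out_word M r ?w \<in> states M"
      using out_word_in_lists[OF mealy_automaton that, of ?w] replicate_one by simp
    then show ?thesis
      using replicate_one states_subset_Syn reach_state
      by (auto simp: modified_state_fun_def simp del: M_simps)
  qed
  then show "p = q"
    using state_eq_if_out_word_eq[OF pq replicate_one] pq eq by metis
qed

section \<open>Right cancellation and faithfulness of products\<close>

lemma out_word_surj:
  assumes "q \<in> states M" "v \<in> lists (carrier G)"
  shows "\<exists>u\<in>lists (carrier G). out_word M q u = v"
  using assms(2,1)
proof (induction v arbitrary: q)
  case (Cons a v)
  \<comment> \<open>The letter solving \<open>?b \<otimes> inv (hd q) = a\<close>.\<close>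
  let ?b = "a \<otimes> hd q"
  have hd: "hd q \<in> carrier G"
    using hd_in_carrier Cons.prems by blast
  obtain u where "u \<in> lists (carrier G)" "out_word M (tl q @ [?b]) u = v"
    using Cons.IH[of "tl q @ [?b]"] trans_in_states Cons.prems Cons.hyps(1) hd by blast
  then show ?case
    using hd Cons.hyps(1) by (intro bexI[of _ "?b # u"]) (auto simp: m_assoc)
qed (auto intro: bexI[of _ "[]"])

text \<open>The rightmost factor acts first and is surjective, so every \<open>v\<close> is one of
  its outputs.\<close>

lemma act_cancel:
  assumes "q \<in> states M"
    and "\<And>u. u \<in> lists (carrier G) \<Longrightarrow> act M (ps @ [q]) u = act M (rs @ [q]) u"
    and "v \<in> lists (carrier G)"
  shows "act M ps v = act M rs v"
proof -
  obtain u where "u \<in> lists (carrier G)" "out_word M q u = v"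
    using out_word_surj[OF assms(1,3)] by blast
  then show ?thesis
    using assms(2)[of u] by simp
qed

lemma step_snoc_state:
  assumes "q \<in> states M" "w \<in> states M"
  shows "step M (ps @ [q]) w = step M ps (out_word M q w) @ [w]"
  using assms by (simp add: step_append trans_word_eq)

text \<open>Induction on the length of the shorter product. The strict inequality excludes the
  second alternative for equal lengths, so such products are already known to be equal before
  identity products are ruled out.\<close>

lemma act_eq_cases:
  assumes "ps \<in> lists (states M)" "qs \<in> lists (states M)" "length ps \<le> length qs"
    and "\<And>u. u \<in> lists (carrier G) \<Longrightarrow> act M ps u = act M qs u"
  shows "ps = qs \<or> (length ps < length qs \<and>
    (\<exists>cs\<in>lists (states M). cs \<noteq> [] \<and> (\<forall>u\<in>lists (carrier G). act M cs u = u)))"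
  using assms
proof (induction "length ps" arbitrary: ps qs)
  case 0
  \<comment> \<open>The empty product acts as the identity, so a nonempty \<open>qs\<close> serves
    as \<open>cs\<close>.\<close>
  then have "act M qs u = u" if "u \<in> lists (carrier G)" for u
    using "0.prems"(4)[OF that] by simp
  then show ?case
    using "0.hyps" "0.prems"(2) by (cases "qs = []") auto
next
  case (Suc n)
  obtain ps' p where ps: "ps = ps' @ [p]"
    using Suc.hyps(2) by (metis length_Suc_conv_rev)
  obtain qs' q where qs: "qs = qs' @ [q]"
    using Suc.hyps(2) Suc.prems(3) by (metis Suc_le_length_iff append_butlast_last_id list.distinct(1))
  have in_states: "ps' \<in> lists (states M)" "p \<in> states M" "qs' \<in> lists (states M)" "q \<in> states M"
    using Suc.prems(1,2) by (simp_all add: ps qs del: M_simps)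
  have len: "n = length ps'" "length ps' \<le> length qs'"
    using Suc.hyps(2) Suc.prems(3) by (simp_all add: ps qs)
  show ?case
  proof (cases "p = q")
    case True
    have "act M ps' u = act M qs' u" if "u \<in> lists (carrier G)" for u
      using act_cancel[OF in_states(2) _ that, of ps' qs'] Suc.prems(4) by (simp add: ps qs True)
    from Suc.hyps(1)[OF len(1) in_states(1,3) len(2) this] show ?thesis
      by (auto simp: ps qs True)
  next
    case False
    define w where "w = replicate k \<one>"
    have w: "w \<in> states M" "w \<in> lists (carrier G)"
      using replicate_one by (auto simp: w_def)
    let ?ps = "step M ps' (out_word M p w)" and ?qs = "step M qs' (out_word M q w)"
    have out: "out_word M p w \<in> states M" "out_word M q w \<in> states M"
      using out_word_in_lists[OF mealy_automaton in_states(2), of w]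
        out_word_in_lists[OF mealy_automaton in_states(4), of w] w by simp_all
    have neq: "out_word M p w \<noteq> out_word M q w"
      using state_eq_if_out_word_eq[OF in_states(2,4) w(1)] False by blast
    have steps: "?ps \<in> lists (states M)" "?qs \<in> lists (states M)"
      using out step_in_lists[OF mealy_automaton in_states(1), of "out_word M p w"]
        step_in_lists[OF mealy_automaton in_states(3), of "out_word M q w"] by simp_all
    have "act M (step M ps w) u = act M (step M qs w) u" if "u \<in> lists (carrier G)" for u
      using act_step_eqI[OF Suc.prems(4) w(2) that] by blast
    then have "act M (?ps @ [w]) u = act M (?qs @ [w]) u" if "u \<in> lists (carrier G)" for u
      using that step_snoc_state[OF in_states(2) w(1)] step_snoc_state[OF in_states(4) w(1)]
      by (simp add: ps qs)
    then have "act M ?ps u = act M ?qs u" if "u \<in> lists (carrier G)" for u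
      using act_cancel[OF w(1)] that by blast
    moreover have "n = length ?ps" "length ?ps \<le> length ?qs"
      using len by simp_all
    ultimately consider "?ps = ?qs" | "length ps' < length qs'"
      "\<exists>cs\<in>lists (states M). cs \<noteq> [] \<and> (\<forall>u\<in>lists (carrier G). act M cs u = u)"
      using Suc.hyps(1)[of ?ps ?qs] steps by (metis length_step)
    then show ?thesis
    proof cases
      case 1
      show ?thesis
      \<comment> \<open>If \<open>ps'\<close> is empty, both products are single states and the
        hypothesis at \<open>w\<close> itself contradicts \<open>neq\<close>.\<close>
      proof (cases ps' rule: rev_cases)
        case Nil
        then have "length ?qs = 0"
          using 1 by (metis length_step list.size(3))
        then have "qs' = []"
          by simp
        then have "out_word M p w = out_word M q w"
          using Suc.prems(4)[OF w(2)] Nil by (simp add: ps qs)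
        then show ?thesis
          using neq by blast
      next
        case (snoc ps'' p')
        moreover have "length qs' = length ps'"
          using 1 by (metis length_step)
        ultimately obtain qs'' q' where qs': "qs' = qs'' @ [q']"
          by (cases qs' rule: rev_cases) auto
        have "p' \<in> states M" "q' \<in> states M"
          using in_states snoc qs' by simp_all
        \<comment> \<open>The outputs of \<open>p\<close> and \<open>q\<close> on \<open>w\<close>
          are words of length \<open>k\<close>, so they overwrite the next factors \<open>p'\<close>
          and \<open>q'\<close>.\<close>
        then have "out_word M p w = last ?ps" "out_word M q w = last ?qs"
          using out step_snoc_state by (simp_all add: snoc qs' del: M_simps)
        then show ?thesis
          using 1 neq by simp
      qed
    next
      case 2
      then show ?thesis
        by (simp add: ps qs)
    qed
  qed
qed

lemma no_identity_product:
  assumes "card (carrier G) > 1" "cs \<in> lists (states M)"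
    and id: "\<And>u. u \<in> lists (carrier G) \<Longrightarrow> act M cs u = u"
  shows "cs = []"
proof (cases cs rule: rev_cases)
  case (snoc ds q)
  have in_states: "q \<in> states M"
    using assms(2) by (simp add: snoc)
  \<comment> \<open>Nontriviality yields a second constant word of length \<open>k\<close>.\<close>
  obtain x where x: "x \<in> carrier G" "x \<noteq> \<one>"
    using assms(1) by (metis is_singletonI' is_singleton_altdef less_irrefl
        one_closed empty_iff)
  have step_id: "act M (step M cs w) u = u" if "w \<in> lists (carrier G)" "u \<in> lists (carrier G)" for w u
    using act_step_eqI[of "carrier G" M cs "[]" w u] id that by simp
  let ?v = "replicate k \<one>" and ?w = "replicate k x"
  have v: "?v \<in> states M" "?v \<in> lists (carrier G)" and w: "?w \<in> states M" "?w \<in> lists (carrier G)"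
    using x by (auto simp: in_lists_conv_set)
  \<comment> \<open>Both sections act as the identity and have equal length, so only the first
    alternative of \<open>act_eq_cases\<close> remains; their last entries are \<open>?v\<close> and
    \<open>?w\<close>.\<close>
  have "step M cs ?v = step M cs ?w"
    using act_eq_cases[of "step M cs ?v" "step M cs ?w"] step_id v w
      step_in_lists[OF mealy_automaton assms(2), of ?v] step_in_lists[OF mealy_automaton assms(2), of ?w]
    by (metis M_simps(2) length_step less_irrefl order_refl)
  then have "?v = ?w"
    using step_snoc_state[OF in_states v(1)] step_snoc_state[OF in_states w(1)] by (simp add: snoc)
  then show ?thesis
    using k_pos x(2) by simp
qed

lemma act_faithful:
  assumes "card (carrier G) > 1" "ps \<in> lists (states M)" "qs \<in> lists (states M)"
    and "\<And>u. u \<in> lists (alphabet M) \<Longrightarrow> act M ps u = act M qs u"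
  shows "ps = qs"
proof -
  \<comment> \<open>\<open>act_eq_cases\<close> expects the shorter product first; the general case
    follows by symmetry.\<close>
  have *: "ps = qs" if "ps \<in> lists (states M)" "qs \<in> lists (states M)" "length ps \<le> length qs"
    "\<And>u. u \<in> lists (carrier G) \<Longrightarrow> act M ps u = act M qs u" for ps qs
    using act_eq_cases[OF that] no_identity_product[OF assms(1)] by blast
  show ?thesis
    using *[of ps qs] *[of qs ps] assms(2-4) by (metis M_simps(2) nle_le)
qed

end

theorem proposition7:
  fixes G :: "('a, 'b) monoid_scheme" and k :: nat
  assumes "group G" and "finite (carrier G)" and "k > 1"
  shows "reset_mealy (de_bruijn_mealy k G) \<and>
    inj_on (modified_state_fun (de_bruijn_mealy k G)) (states (de_bruijn_mealy k G)) \<and>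
    (card (carrier G) > 1 \<longrightarrow>
      free_semigroup (automaton_semigroup (de_bruijn_mealy k G))
        (compose (lists (carrier G))))"
proof -
  interpret group_de_bruijn G k
    using assms by (intro group_de_bruijn.intro group_de_bruijn_axioms.intro) simp_all
  have "free_semigroup (automaton_semigroup M) (compose (lists (carrier G)))"
    if "card (carrier G) > 1"
  proof -
    have "free_semigroup (automaton_semigroup M) (compose (lists (alphabet M)))"
      by (rule free_automaton_semigroup[OF mealy_automaton]) (rule act_faithful[OF that])
    then show ?thesis
      by simp
  qed
  then show ?thesis
    using reset_mealy inj_on_modified_state_fun by blast
qed

end
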